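(* The Diophantine equation $P_3(x)=P_4(y)$ has infinitely many solutions in integers $x,y\ge 0$.
   Context: For a positive integer $m$ and a non-negative integer $n$, $P_m(n)$ denotes the number of partitions of $n$ into parts from $\{1,2,\dots,m\}$ (repetitions allowed, order of parts disregarded); $P_m(0)=1$. Equivalently, $\prod_{a=1}^m\frac{1}{1-x^a}=\sum_{n=0}^\infty P_m(n)x^n$. *)

theory Defs
  imports "HOL-Library.Multiset"
begin

text \<open>A partition of \<open>n\<close> into parts from \<open>{1..m}\<close> is a finite multiset of such parts with sum \<open>n\<close>.\<close>

definition partitions_into :: "nat \<Rightarrow> nat \<Rightarrow> nat multiset set" where
  "partitions_into m n = {M. set_mset M \<subseteq> {1..m} \<and> sum_mset M = n}"

definition P :: "nat \<Rightarrow> nat \<Rightarrow> nat" where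
  "P m n = card (partitions_into m n)"

lemma finite_partitions_into: "finite (partitions_into m n)"
proof (rule finite_subset)
  show "partitions_into m n \<subseteq> mset ` {xs. set xs \<subseteq> {1..m} \<and> length xs \<le> n}"
  proof
    fix M assume M: "M \<in> partitions_into m n"
    obtain xs where xs: "M = mset xs" by (metis ex_mset)
    have *: "set ys \<subseteq> {1..m} \<Longrightarrow> length ys \<le> sum_list ys" for ys
      by (induction ys) auto
    from M xs have "set xs \<subseteq> {1..m}" "sum_list xs = n"
      by (auto simp: partitions_into_def sum_mset_sum_list)
    with * [of xs] xs show "M \<in> mset ` {xs. set xs \<subseteq> {1..m} \<and> length xs \<le> n}"
      by auto
  qed
  show "finite (mset ` {xs. set xs \<subseteq> {1..m} \<and> length xs \<le> n})"
    by (intro finite_imageI finite_lists_length_le) auto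
qed

lemma P_0: "P m 0 = 1"
proof -
  have "partitions_into m 0 = {{#}}"
  proof (intro equalityI subsetI)
    fix M assume "M \<in> partitions_into m 0"
    then have "set_mset M \<subseteq> {1..m}" "\<forall>x\<in>#M. x = 0"
      by (simp_all add: partitions_into_def)
    then have "set_mset M = {}" by fastforce
    then show "M \<in> {{#}}" by simp
  qed (simp add: partitions_into_def)
  then show ?thesis by (simp add: P_def)
qed

end

theory Submission
  imports Defs
begin

text \<open>With \<open>z = x + 3\<close> and \<open>v = y + 4\<close>, the number \<open>P 3 x\<close> is \<open>z\<^sup>2 / 12\<close> rounded to an integer and, for
  even \<open>v\<close>, the number \<open>P 4 y\<close> is \<open>v\<^sup>2 (v + 3) / 144\<close> rounded to an integer. No rounding takes place
  for \<open>z = 6 w\<close> and for \<open>v = 12 t\<close>, so the equation becomes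
  \<open>w\<^sup>2 = t\<^sup>2 (4 t + 1)\<close>. This curve is singular and is parametrised by \<open>4 t + 1 = (2 s + 1)\<^sup>2\<close>,
  i.e. \<open>t = s (s + 1)\<close> and \<open>w = t (2 s + 1)\<close>.\<close>

lemma partitions_into_mono: "m \<le> k \<Longrightarrow> partitions_into m n \<subseteq> partitions_into k n"
  by (fastforce simp: partitions_into_def)

lemma partitions_into_Suc_less:
  assumes "n < Suc m"
  shows "partitions_into (Suc m) n = partitions_into m n"
proof
  show "partitions_into (Suc m) n \<subseteq> partitions_into m n"
  proof
    fix M assume M: "M \<in> partitions_into (Suc m) n"
    have "Suc m \<notin># M"
    proof
      assume "Suc m \<in># M"
      then obtain N where "M = add_mset (Suc m) N" by (metis mset_add)
      with M assms show False by (simp add: partitions_into_def)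
    qed
    with M show "M \<in> partitions_into m n"
      by (auto simp: partitions_into_def atLeastAtMostSuc_conv)
  qed
qed (simp add: partitions_into_mono)

text \<open>Sort the partitions by whether the part \<open>Suc m\<close> occurs; if it does, remove
  one copy of it.\<close>

lemma partitions_into_Suc_add:
  "partitions_into (Suc m) (n + Suc m) =
     partitions_into m (n + Suc m) \<union> add_mset (Suc m) ` partitions_into (Suc m) n"
proof
  show "partitions_into (Suc m) (n + Suc m) \<subseteq>
     partitions_into m (n + Suc m) \<union> add_mset (Suc m) ` partitions_into (Suc m) n"
  proof
    fix M assume M: "M \<in> partitions_into (Suc m) (n + Suc m)"
    show "M \<in> partitions_into m (n + Suc m) \<union> add_mset (Suc m) ` partitions_into (Suc m) n"
    proof (cases "Suc m \<in># M")
      case True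
      then obtain N where "M = add_mset (Suc m) N" by (metis mset_add)
      with M show ?thesis by (auto simp: partitions_into_def)
    next
      case False
      with M show ?thesis
        by (auto simp: partitions_into_def atLeastAtMostSuc_conv)
    qed
  qed
qed (fastforce simp: partitions_into_def)

lemma P_Suc_less: "n < Suc m \<Longrightarrow> P (Suc m) n = P m n"
  by (simp add: P_def partitions_into_Suc_less)

lemma P_Suc_add: "P (Suc m) (n + Suc m) = P m (n + Suc m) + P (Suc m) n"
proof -
  have "partitions_into m (n + Suc m) \<inter> add_mset (Suc m) ` partitions_into (Suc m) n = {}"
    by (auto simp: partitions_into_def)
  then show ?thesis
    unfolding P_def partitions_into_Suc_add
    by (subst card_Un_disjoint) (simp_all add: finite_partitions_into card_image inj_on_def)
qed

lemma P_1: "P 1 n = 1"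
proof (induction n)
  case (Suc n)
  have "partitions_into 0 (Suc n) = {}"
    by (auto simp: partitions_into_def)
  with Suc P_Suc_add [of 0 n] show ?case by (simp add: P_def)
qed (rule P_0)

lemma P_2_add: "P 2 (n + 2) = Suc (P 2 n)"
  using P_Suc_add [of 1 n] P_1 [of "n + 2"] by (simp add: numeral_2_eq_2)

lemma P_2: "P 2 n = n div 2 + 1"
proof (induction n rule: nat_less_induct)
  case (1 n)
  show ?case
  proof (cases "n < 2")
    case True
    then show ?thesis
      using P_Suc_less [of n 1] P_1 [of n] by (simp add: numeral_2_eq_2)
  next
    case False
    then obtain k where "n = k + 2" by (metis add.commute le_Suc_ex not_less)
    with 1 show ?thesis by (simp add: P_2_add del: add_2_eq_Suc')
  qed
qed

lemma P_3_add: "P 3 (n + 3) = P 3 n + (n + 3) div 2 + 1"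
  using P_Suc_add [of 2 n] by (simp add: P_2 numeral_3_eq_3)

lemma P_3_less: "n < 3 \<Longrightarrow> P 3 n = n div 2 + 1"
  using P_Suc_less [of n 2] by (simp add: P_2 numeral_3_eq_3)

text \<open>As 6 = lcm(2, 3), the parity of the halved numbers is constant along a residue class
  modulo 6, so there the increment is linear.\<close>

lemma P_3_add_6: "P 3 (n + 6) = P 3 n + (n + 3) div 2 + (n + 6) div 2 + 2"
  using P_3_add [of n] P_3_add [of "n + 3"] by (simp add: add.assoc)

text \<open>Linear increments give quadratic values. Residue 3 is the case z = 6 (k + 1), where z^2
  / 12 is exact; residues 0, 2 and 4 are those met when summing up to \<open>P 4\<close>.\<close>

lemma P_3_mult_6:
  "P 3 (6 * k) = 3 * k\<^sup>2 + 3 * k + 1"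
  "P 3 (6 * k + 2) = 3 * k\<^sup>2 + 5 * k + 2"
  "P 3 (6 * k + 3) = 3 * (k + 1)\<^sup>2"
  "P 3 (6 * k + 4) = 3 * k\<^sup>2 + 7 * k + 4"
proof (induction k)
  case 0
  show "P 3 (6 * 0) = 3 * 0\<^sup>2 + 3 * 0 + 1"
    "P 3 (6 * 0 + 2) = 3 * 0\<^sup>2 + 5 * 0 + 2"
    "P 3 (6 * 0 + 3) = 3 * (0 + 1)\<^sup>2"
    "P 3 (6 * 0 + 4) = 3 * 0\<^sup>2 + 7 * 0 + 4"
    using P_3_add [of 0] P_3_add [of 1] by (simp_all add: P_3_less)
next
  case (Suc k)
  have "(6 * k + 3) div 2 = 3 * k + 1" "(6 * k + 5) div 2 = 3 * k + 2"
    "(6 * k + 7) div 2 = 3 * k + 3" "(6 * k + 9) div 2 = 3 * k + 4"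
    "(6 * k + 6) div 2 = 3 * k + 3" "(6 * k + 8) div 2 = 3 * k + 4"
    "(6 * k + 10) div 2 = 3 * k + 5"
    by presburger+
  with Suc P_3_add_6 [of "6 * k"] P_3_add_6 [of "6 * k + 2"]
    P_3_add_6 [of "6 * k + 3"] P_3_add_6 [of "6 * k + 4"]
  show "P 3 (6 * Suc k) = 3 * (Suc k)\<^sup>2 + 3 * Suc k + 1"
    "P 3 (6 * Suc k + 2) = 3 * (Suc k)\<^sup>2 + 5 * Suc k + 2"
    "P 3 (6 * Suc k + 3) = 3 * (Suc k + 1)\<^sup>2"
    "P 3 (6 * Suc k + 4) = 3 * (Suc k)\<^sup>2 + 7 * Suc k + 4"
    by (simp_all add: power2_eq_square algebra_simps)
qed

lemma P_4_add: "P 4 (n + 4) = P 4 n + P 3 (n + 4)"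
  using P_Suc_add [of 3 n] by simp

text \<open>This is the case v = 12 (k + 1), where v^2 (v + 3) / 144 is exact.\<close>

lemma P_4_mult_12: "P 4 (12 * k + 8) = 3 * (k + 1)\<^sup>2 * (4 * k + 5)"
proof (induction k)
  case 0
  show ?case
    using P_3_mult_6(2) [of 1] P_3_mult_6(4) [of 0] P_4_add [of 0] P_4_add [of 4]
    by (simp add: P_0)
next
  case (Suc k)
  \<comment> \<open>Three steps of 4 lead from 12 k + 8 to 12 k + 20. The arguments 12 k + 12, 12 k
    + 16 and 12 k + 20 are split by residue modulo 6 to fit \<open>P_3_mult_6\<close>.\<close>
  have "P 4 (12 * Suc k + 8) =
      P 4 (12 * k + 8) + P 3 (6 * (2 * k + 2)) + P 3 (6 * (2 * k + 2) + 4) + P 3 (6 * (2 * k + 3) + 2)"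
    using P_4_add [of "12 * k + 8"] P_4_add [of "12 * k + 12"] P_4_add [of "12 * k + 16"]
    by (simp add: algebra_simps)
  then show ?case
    unfolding P_3_mult_6 Suc by (simp add: power2_eq_square algebra_simps)
qed

lemma P_3_eq_P_4:
  fixes s :: nat
  assumes "s > 0"
  defines "t \<equiv> s * (s + 1)"
  shows "P 3 (6 * (t * (2 * s + 1)) - 3) = P 4 (12 * t - 4)"
proof -
  have "t > 0" using assms by simp
  \<comment> \<open>Positivity of \<open>w\<close> makes the subtraction genuine: 6 w - 3 = 6 (w -
    1) + 3.\<close>
  have "P 3 (6 * w - 3) = 3 * w\<^sup>2" if "w > 0" for w
    using P_3_mult_6(3) [of "w - 1"] that by (cases w) (simp_all add: add.commute)
  then have "P 3 (6 * (t * (2 * s + 1)) - 3) = 3 * (t * (2 * s + 1))\<^sup>2"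
    using \<open>t > 0\<close> by (metis add_gr_0 mult_pos_pos zero_less_one)
  \<comment> \<open>Here 4 t + 1 = 4 s (s + 1) + 1 = (2 s + 1)^2.\<close>
  also have "\<dots> = 3 * t\<^sup>2 * (4 * t + 1)"
    unfolding t_def by (simp add: power2_eq_square algebra_simps)
  also have "\<dots> = P 4 (12 * t - 4)"
    using P_4_mult_12 [of "t - 1"] \<open>t > 0\<close> by (cases t) (simp_all add: add.commute)
  finally show ?thesis .
qed

theorem theorem3p1: "infinite {(x, y). P 3 x = P 4 y}"
proof -
  define f :: "nat \<Rightarrow> nat \<times> nat" where
    "f s = (6 * (s * (s + 1) * (2 * s + 1)) - 3, 12 * (s * (s + 1)) - 4)" for s
  \<comment> \<open>Injectivity can be read off the second component alone. The shift to
    \<open>Suc s\<close> supplies the hypothesis \<open>s > 0\<close> of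
    \<open>P_3_eq_P_4\<close>.\<close>
  have "strict_mono (snd \<circ> (\<lambda>s. f (Suc s)))"
    by (simp add: f_def strict_mono_Suc_iff)
  then have "inj (\<lambda>s. f (Suc s))"
    by (rule inj_on_imageI2 [OF strict_mono_imp_inj_on])
  then have "infinite (range (\<lambda>s. f (Suc s)))"
    by (simp add: finite_image_iff)
  moreover have "range (\<lambda>s. f (Suc s)) \<subseteq> {(x, y). P 3 x = P 4 y}"
    using P_3_eq_P_4 by (auto simp: f_def simp del: mult_Suc mult_Suc_right)
  ultimately show ?thesis
    by (rule infinite_super [rotated])
qed

end
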